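(* Let $\Sigma=\{a,b\}$. There exist a morphism $h:\Sigma^*\to\Sigma^*$, a finite abelian group $G$ and a monoid morphism $f:\Sigma^*\to G$ satisfying Dekking's conditions (D1)--(D4) with $n=11$, so that $h$ is abelian $11$-power free, and such that $h$ has an infinite fixed point $\Omega_2'\in\Sigma^{\mathbb{N}}$ with the following properties: (i) $aaaa$ is not a factor of $\Omega_2'$; (ii) $bb$ is not a factor of $\Omega_2'$; (iii) $\Omega_2'$ is abelian $11$-power free.
   Context: $\Sigma^*$ is the free monoid of finite words over $\Sigma$, with empty word $\epsilon$; a morphism is a monoid homomorphism, extended letter by letter to infinite words; an infinite word $\Omega$ is a fixed point of $h$ if $h(\Omega)=\Omega$. A factor is a contiguous finite subword. The Parikh vector $\psi(u)$ records the number of occurrences of each letter in $u$. The frequency matrix of $h$ is the matrix whose $i$-th row is the Parikh vector of $h(\sigma_i)$, where $\Sigma=\{\sigma_1,\sigma_2\}$. $\operatorname{Pref}(h)$ is the set of all prefixes (including $\epsilon$ and the full word) of the words $h(\sigma)$, $\sigma\in\Sigma$; $h(\Sigma)=\{h(\sigma):\sigma\in\Sigma\}$. A word $u$ (finite or infinite) is abelian $k$-power free if whenever $u=xv_1\cdots v_ky$ with $\psi(v_1)=\cdots=\psi(v_k)$, one has $v_1=\cdots=v_k=\epsilon$. A morphism $h$ is abelian $n$-power free if $h(u)$ is abelian $n$-power free for every abelian $n$-power free word $u$. Dekking's conditions for $(h,G,f,n)$, $G$ written additively: (D1) The frequency matrix of $h$ is non-singular. (D2) $f(h(\sigma))=0$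 for each $\sigma\in\Sigma$. (D3) The set $f(\operatorname{Pref}(h))$ contains no arithmetic progression $g,g+d,\dots,g+nd$ of length $n+1$ with $d\ne0$. (D4) For any positive integer $r$, if $f(v_1)=\cdots=f(v_r)$ with $v_i\in\operatorname{Pref}(h)\setminus h(\Sigma)$ for all $i$, then either $v_1=\cdots=v_r$ or $v_1'=\cdots=v_r'$, where $v_iv_i'=h(\sigma_{j_i})$ for some $\sigma_{j_i}\in\Sigma$. Dekking's theorem states that (D1)--(D4) with $n>1$ imply that $h$ is abelian $n$-power free. *)

theory Defs
  imports "HOL-Analysis.Cartesian_Space" "HOL-Algebra.Group"
    "HOL-Library.Sublist" "HOL-Library.Omega_Words_Fun"
begin

datatype letter = La | Lb

instance letter :: finite
proof
  have "(UNIV :: letter set) = {La, Lb}"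
    using letter.exhaust by auto
  then show "finite (UNIV :: letter set)"
    by (metis finite.emptyI finite.insertI)
qed

definition word_monoid :: "'a list monoid" where
  "word_monoid = \<lparr>carrier = UNIV, mult = (@), one = []\<rparr>"

text \<open>The library's \<^const>\<open>hom\<close> only requires compatibility with multiplication.\<close>

definition monoid_hom :: "('a, 'm) monoid_scheme \<Rightarrow> ('b, 'n) monoid_scheme \<Rightarrow> ('a \<Rightarrow> 'b) \<Rightarrow> bool" where
  "monoid_hom M N f \<longleftrightarrow> f \<in> hom M N \<and> f \<one>\<^bsub>M\<^esub> = \<one>\<^bsub>N\<^esub>"

abbreviation word_morphism :: "('a list \<Rightarrow> 'b list) \<Rightarrow> bool" where
  "word_morphism h \<equiv> monoid_hom word_monoid word_monoid h"

text \<open>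
  \<open>infinite_image h w w'\<close> says that the concatenation \<open>h(w\<^sub>0) h(w\<^sub>1) \<dots>\<close> is the infinite
  word \<open>w'\<close>. The first conjunct ensures that this concatenation is infinite, which may fail if
  \<open>h\<close> erases letters.
\<close>

definition infinite_image :: "('a list \<Rightarrow> 'b list) \<Rightarrow> (nat \<Rightarrow> 'a) \<Rightarrow> (nat \<Rightarrow> 'b) \<Rightarrow> bool" where
  "infinite_image h w w' \<longleftrightarrow>
     (\<forall>n. \<exists>m. n \<le> length (h (w [0 \<rightarrow> m]))) \<and>
     (\<forall>m. h (w [0 \<rightarrow> m]) = w' [0 \<rightarrow> length (h (w [0 \<rightarrow> m]))])"

definition infinite_fixed_point :: "('a list \<Rightarrow> 'a list) \<Rightarrow> (nat \<Rightarrow> 'a) \<Rightarrow> bool" where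
  "infinite_fixed_point h w \<longleftrightarrow> infinite_image h w w"

definition is_factor :: "'a list \<Rightarrow> (nat \<Rightarrow> 'a) \<Rightarrow> bool" where
  "is_factor u w \<longleftrightarrow> (\<exists>x y. w = (x @ u) \<frown> y)"

definition parikh :: "'a::finite list \<Rightarrow> nat ^ 'a" where
  "parikh u = (\<chi> s. count_list u s)"

definition frequency_matrix :: "('a::finite list \<Rightarrow> 'a list) \<Rightarrow> real ^ 'a ^ 'a" where
  "frequency_matrix h = (\<chi> i j. real (parikh (h [i]) $ j))"

definition abelian_power_free :: "nat \<Rightarrow> 'a::finite list \<Rightarrow> bool" where
  "abelian_power_free k u \<longleftrightarrow>
     (\<forall>x vs y. u = x @ concat vs @ y \<and> length vs = k \<and>
        (\<forall>v\<in>set vs. \<forall>v'\<in>set vs. parikh v = parikh v') \<longrightarrow> (\<forall>v\<in>set vs. v = []))"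

definition abelian_power_free_inf :: "nat \<Rightarrow> (nat \<Rightarrow> 'a::finite) \<Rightarrow> bool" where
  "abelian_power_free_inf k w \<longleftrightarrow>
     (\<forall>x vs y. w = (x @ concat vs) \<frown> y \<and> length vs = k \<and>
        (\<forall>v\<in>set vs. \<forall>v'\<in>set vs. parikh v = parikh v') \<longrightarrow> (\<forall>v\<in>set vs. v = []))"

definition abelian_power_free_morphism :: "nat \<Rightarrow> ('a::finite list \<Rightarrow> 'a list) \<Rightarrow> bool" where
  "abelian_power_free_morphism n h \<longleftrightarrow>
     (\<forall>u. abelian_power_free n u \<longrightarrow> abelian_power_free n (h u)) \<and>
     (\<forall>w w'. abelian_power_free_inf n w \<and> infinite_image h w w' \<longrightarrow> abelian_power_free_inf n w')"

definition letter_images :: "('a list \<Rightarrow> 'b list) \<Rightarrow> 'b list set" where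
  "letter_images h = range (\<lambda>s. h [s])"

definition Pref :: "('a list \<Rightarrow> 'b list) \<Rightarrow> 'b list set" where
  "Pref h = {v. \<exists>s. Sublist.prefix v (h [s])}"

definition dekking_D1 :: "('a::finite list \<Rightarrow> 'a list) \<Rightarrow> bool" where
  "dekking_D1 h \<longleftrightarrow> invertible (frequency_matrix h)"

definition dekking_D2 :: "('a list \<Rightarrow> 'a list) \<Rightarrow> ('g, 'm) monoid_scheme \<Rightarrow> ('a list \<Rightarrow> 'g) \<Rightarrow> bool" where
  "dekking_D2 h G f \<longleftrightarrow> (\<forall>s. f (h [s]) = \<one>\<^bsub>G\<^esub>)"

text \<open>
  The group is written multiplicatively, so \<open>g + i d\<close> becomes \<open>g \<otimes> d [^] i\<close>.
  The terms of a progression need not be distinct: if \<open>d\<close> has order at most \<open>n\<close>, then the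
  progression wraps around.
\<close>

definition dekking_D3 ::
  "('a list \<Rightarrow> 'a list) \<Rightarrow> ('g, 'm) monoid_scheme \<Rightarrow> ('a list \<Rightarrow> 'g) \<Rightarrow> nat \<Rightarrow> bool" where
  "dekking_D3 h G f n \<longleftrightarrow>
     \<not> (\<exists>g\<in>carrier G. \<exists>d\<in>carrier G. d \<noteq> \<one>\<^bsub>G\<^esub> \<and>
          (\<forall>i\<le>n. g \<otimes>\<^bsub>G\<^esub> d [^]\<^bsub>G\<^esub> i \<in> f ` Pref h))"

text \<open>
  A word may be a proper prefix of several letter images, so its complement \<open>v'\<close> need not be
  unique; the condition is required for every choice of complements.
\<close>

definition dekking_D4 :: "('a list \<Rightarrow> 'a list) \<Rightarrow> ('a list \<Rightarrow> 'g) \<Rightarrow> bool" where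
  "dekking_D4 h f \<longleftrightarrow>
     (\<forall>r\<ge>1. \<forall>v v' :: nat \<Rightarrow> 'a list.
        (\<forall>i\<in>{1..r}. v i \<in> Pref h - letter_images h \<and> v i @ v' i \<in> letter_images h) \<and>
        (\<forall>i\<in>{1..r}. \<forall>j\<in>{1..r}. f (v i) = f (v j)) \<longrightarrow>
        (\<forall>i\<in>{1..r}. \<forall>j\<in>{1..r}. v i = v j) \<or> (\<forall>i\<in>{1..r}. \<forall>j\<in>{1..r}. v' i = v' j))"

definition dekking_conditions ::
  "('a::finite list \<Rightarrow> 'a list) \<Rightarrow> ('g, 'm) monoid_scheme \<Rightarrow> ('a list \<Rightarrow> 'g) \<Rightarrow> nat \<Rightarrow> bool" where
  "dekking_conditions h G f n \<longleftrightarrow>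
     dekking_D1 h \<and> dekking_D2 h G f \<and> dekking_D3 h G f n \<and> dekking_D4 h f"

end

theory Submission
  imports Defs "HOL-Algebra.Elementary_Groups" "HOL-Library.Multiset"
begin

text \<open>
  The witness is \<open>h(a) = aabaaab\<close>, \<open>h(b) = aababababab\<close>, \<open>f(a) = 1\<close>, \<open>f(b) = 4\<close> in the integers
  modulo 13. A progression of 12 terms modulo 13 omits only one residue, while the prefix sums omit
  both 5 and 10, which gives (D3). Since both images begin with \<open>a\<close>, end with \<open>b\<close> and contain neither
  \<open>aaaa\<close> nor \<open>bb\<close>, the same holds for every product of images.

  For Dekking's theorem, the boundaries of an abelian power in \<open>h(u)\<close> have \<open>f\<close>-values in arithmetic
  progression, so by (D3) the blocks have \<open>f\<close>-value 0. By (D4) all boundaries then cut images after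
  the same prefix or before the same complement, and moving them to image boundaries gives blocks
  that are images of factors of \<open>u\<close>. By (D1) these factors form an abelian power.
\<close>

section \<open>Morphisms and Parikh vectors\<close>

lemma word_morphism_append: "word_morphism h \<Longrightarrow> h (u @ v) = h u @ h v"
  by (simp add: monoid_hom_def hom_def word_monoid_def)

lemma word_morphism_Nil: "word_morphism h \<Longrightarrow> h [] = []"
  by (simp add: monoid_hom_def word_monoid_def)

lemma word_morphism_Cons: "word_morphism h \<Longrightarrow> h (c # u) = h [c] @ h u"
  using word_morphism_append[of h "[c]" u] by simp

lemma word_morphism_prefix:
  assumes "word_morphism h" and "Sublist.prefix u v"
  shows "Sublist.prefix (h u) (h v)"
  using assms by (auto simp: Sublist.prefix_def word_morphism_append)

lemma parikh_nth [simp]: "parikh u $ s = count_list u s"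
  by (simp add: parikh_def)

lemma parikh_append [simp]: "parikh (u @ v) = parikh u + parikh v"
  by (simp add: vec_eq_iff)

lemma parikh_eq_iff_mset: "parikh u = parikh v \<longleftrightarrow> mset u = mset v"
  by (simp add: vec_eq_iff multiset_eq_iff count_mset)

lemma parikh_Nil [simp]: "parikh [] = 0"
  by (simp add: vec_eq_iff)

lemma parikh_eq_0_iff [simp]: "parikh u = 0 \<longleftrightarrow> u = []"
  using parikh_eq_iff_mset[of u "[]"] by simp

text \<open>Linearity over the letters of \<open>u\<close>: the right-hand side is the row vector
  \<open>parikh u\<close> times the frequency matrix, with entries still in
  \<open>nat\<close>.\<close>

lemma parikh_morphism:
  fixes h :: "'a::finite list \<Rightarrow> 'a list"
  assumes h: "word_morphism h"
  shows "parikh (h u) $ j = (\<Sum>i\<in>UNIV. parikh u $ i * parikh (h [i]) $ j)"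
proof (induction u)
  case Nil
  then show ?case by (simp add: word_morphism_Nil[OF h])
next
  case (Cons c u)
  have "(\<Sum>i\<in>UNIV. parikh (c # u) $ i * parikh (h [i]) $ j) =
     (\<Sum>i\<in>UNIV. (if i = c then parikh (h [i]) $ j else 0) + parikh u $ i * parikh (h [i]) $ j)"
    by (rule sum.cong) auto
  also have "\<dots> = parikh (h [c]) $ j + (\<Sum>i\<in>UNIV. parikh u $ i * parikh (h [i]) $ j)"
    by (simp add: sum.distrib)
  finally show ?case
    using Cons by (simp add: word_morphism_Cons[OF h, of c u])
qed

text \<open>By (D1), right multiplication by the frequency matrix can be undone. The counts are cast
  to reals as \<open>R\<close> so that the inverse matrix \<open>B\<close> applies.\<close>

lemma parikh_morphism_inject:
  fixes h :: "'a::finite list \<Rightarrow> 'a list"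
  assumes h: "word_morphism h" and D1: "dekking_D1 h" and eq: "parikh (h u) = parikh (h v)"
  shows "parikh u = parikh v"
proof -
  define F where "F = frequency_matrix h"
  define R :: "'a list \<Rightarrow> real ^ 'a" where "R = (\<lambda>u. \<chi> i. real (parikh u $ i))"
  have R: "R w v* F = R (h w)" for w
    by (simp add: vec_eq_iff R_def F_def frequency_matrix_def vector_matrix_mult_def
        parikh_morphism[OF h, of w, simplified])
  obtain B where B: "F ** B = mat 1"
    using D1 by (auto simp: dekking_D1_def invertible_def F_def)
  have "R w = R (h w) v* B" for w
    by (simp add: R[symmetric] vector_matrix_mul_assoc B)
  moreover have "R (h u) = R (h v)"
    using eq by (simp add: R_def vec_eq_iff)
  ultimately have "R u = R v" by metis
  then show ?thesis by (simp add: R_def vec_eq_iff)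
qed

lemma morphism_nonerasing:
  fixes h :: "'a::finite list \<Rightarrow> 'a list"
  assumes "word_morphism h" and "dekking_D1 h" and "h u = []"
  shows "u = []"
  using parikh_morphism_inject[OF assms(1,2), of u "[]"] assms
  by (simp add: word_morphism_Nil)

text \<open>Commutativity of \<open>G\<close> makes \<open>f\<close> depend on letter counts alone,
  so all blocks of an abelian power share one value.\<close>

lemma group_hom_mset_cong:
  assumes G: "comm_group G" and f: "monoid_hom word_monoid G f" and "mset u = mset v"
  shows "f u = f v"
proof -
  interpret comm_group G by (rule G)
  have app: "f (x @ y) = f x \<otimes>\<^bsub>G\<^esub> f y" and cl: "f x \<in> carrier G" for x y
    using f by (auto simp: monoid_hom_def hom_def word_monoid_def)
  show ?thesis using assms(3)
  proof (induction u arbitrary: v)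
    case Nil
    then show ?case by simp
  next
    case (Cons c u)
    then have "c \<in> set v" by (metis list.set_intros(1) set_mset_mset)
    then obtain v1 v2 where v: "v = v1 @ c # v2" by (meson split_list)
    then have "f u = f (v1 @ v2)" using Cons.prems by (intro Cons.IH) simp
    moreover have "f (c # u) = f [c] \<otimes>\<^bsub>G\<^esub> f u" "f (c # v2) = f [c] \<otimes>\<^bsub>G\<^esub> f v2"
      using app[of "[c]" u] app[of "[c]" v2] by simp_all
    ultimately show ?case by (simp add: v app cl m_lcomm)
  qed
qed

lemma group_hom_concat:
  assumes G: "comm_group G" and f: "monoid_hom word_monoid G f"
    and "\<And>v. v \<in> set vs \<Longrightarrow> f v = d" and "d \<in> carrier G"
  shows "f (concat vs) = d [^]\<^bsub>G\<^esub> length vs"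
proof -
  interpret comm_group G by (rule G)
  have app: "f (x @ y) = f x \<otimes>\<^bsub>G\<^esub> f y" and nil: "f [] = \<one>\<^bsub>G\<^esub>" for x y
    using f by (auto simp: monoid_hom_def hom_def word_monoid_def)
  show ?thesis using assms(3)
  proof (induction vs)
    case (Cons v vs)
    then show ?case using assms(4) nat_pow_Suc2[of d "length vs"] by (simp add: app)
  qed (simp add: nil)
qed

text \<open>Whole images contribute nothing to \<open>f\<close>, so the value at a cut of
  \<open>h u\<close> depends only on the part of the letter image before the cut.\<close>

lemma group_hom_morphism_one:
  assumes G: "comm_group G" and f: "monoid_hom word_monoid G f"
    and h: "word_morphism h" and D2: "dekking_D2 h G f"
  shows "f (h u) = \<one>\<^bsub>G\<^esub>"
proof -
  interpret comm_group G by (rule G)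
  have app: "f (x @ y) = f x \<otimes>\<^bsub>G\<^esub> f y" and nil: "f [] = \<one>\<^bsub>G\<^esub>" for x y
    using f by (auto simp: monoid_hom_def hom_def word_monoid_def)
  show ?thesis
  proof (induction u)
    case (Cons c u)
    then show ?case
      using D2 by (simp add: word_morphism_Cons[OF h, of c u] app dekking_D2_def)
  qed (simp add: nil word_morphism_Nil[OF h])
qed

section \<open>Dekking's theorem\<close>

text \<open>Locates a cut of \<open>h u\<close> inside a letter image. Requiring
  \<open>t' \<noteq> []\<close> assigns a cut between two images to the later one, so
  \<open>t\<close> is always a proper prefix; only the end of \<open>h u\<close> needs its own
  case.\<close>

lemma prefix_morphism_image_cases:
  assumes h: "word_morphism h" and "Sublist.prefix p (h u)"
  shows "p = h u \<or> (\<exists>z c t t'. Sublist.prefix (z @ [c]) u \<and> p = h z @ t \<and> t @ t' = h [c] \<and> t' \<noteq> [])"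
  using assms(2)
proof (induction u rule: rev_induct)
  case Nil
  then show ?case by (simp add: word_morphism_Nil[OF h])
next
  case (snoc c u)
  then consider "Sublist.prefix p (h u)" | t where "p = h u @ t" "Sublist.prefix t (h [c])"
    by (auto simp: word_morphism_append[OF h] prefix_append)
  then show ?case
  proof cases
    case 1
    then consider "p = h u"
      | z c t t' where "Sublist.prefix (z @ [c]) u" "p = h z @ t" "t @ t' = h [c]" "t' \<noteq> []"
      using snoc.IH by auto
    then show ?thesis
    proof cases
      case 1
      \<comment> \<open>After \<open>c\<close> is appended, the old end of the image is again the
        end if \<open>c\<close> is erased, and otherwise a cut just before \<open>h [c]\<close> with
        \<open>t = []\<close>.\<close>
      then show ?thesis
        by (cases "h [c] = []") (force simp: word_morphism_append[OF h])+
    next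
      case 2
      then show ?thesis by (metis prefix_prefix)
    qed
  next
    case 2
    then obtain t' where t': "t @ t' = h [c]" by (auto simp: Sublist.prefix_def)
    show ?thesis
    proof (cases "t' = []")
      case True
      then show ?thesis using 2 t' by (simp add: word_morphism_append[OF h])
    next
      case False
      then show ?thesis using 2 t' by blast
    qed
  qed
qed

text \<open>Prefixes of \<open>u\<close> are comparable, and the growth of the Parikh vectors forces
  them to increase with \<open>i\<close>. Successive differences are then adjacent factors of
  \<open>u\<close> whose images all have Parikh vector \<open>q\<close>; by (D1) they form an
  abelian power, which must be trivial.\<close>

lemma shifted_abelian_power_trivial:
  fixes h :: "'a::finite list \<Rightarrow> 'a list"
  assumes h: "word_morphism h" and D1: "dekking_D1 h" and free: "abelian_power_free n u"
    and n: "n > 0" and W: "\<And>i. i \<le> n \<Longrightarrow> Sublist.prefix (W i) u"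
    and step: "\<And>i. i < n \<Longrightarrow> parikh (h (W (Suc i))) = parikh (h (W i)) + q"
  shows "q = 0"
proof -
  have "\<exists>w. W (Suc i) = W i @ w" if i: "i < n" for i
  proof -
    have "Sublist.prefix (W i) (W (Suc i)) \<or> Sublist.prefix (W (Suc i)) (W i)"
      using W[of i] W[of "Suc i"] i prefix_same_cases by fastforce
    then show ?thesis
    proof
      \<comment> \<open>In this order \<open>parikh (h w) + q = 0\<close>; natural counts cannot
        cancel, so \<open>w\<close> is empty and both prefixes coincide.\<close>
      assume "Sublist.prefix (W (Suc i)) (W i)"
      then obtain w where w: "W i = W (Suc i) @ w" by (auto simp: Sublist.prefix_def)
      then have "parikh (h (W i)) = parikh (h (W (Suc i))) + parikh (h w)"
        by (simp add: word_morphism_append[OF h])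
      with step[OF i] have "parikh (h w) = 0"
        by (auto simp: vec_eq_iff)
      then have "w = []" using morphism_nonerasing[OF h D1] by simp
      with w show ?thesis by auto
    qed (auto simp: Sublist.prefix_def)
  qed
  then obtain w where w: "\<And>i. i < n \<Longrightarrow> W (Suc i) = W i @ w i" by metis
  have q: "parikh (h (w i)) = q" if "i < n" for i
    using step[OF that] w[OF that] by (simp add: word_morphism_append[OF h])
  define ws where "ws = map w [0..<n]"
  have "W i = W 0 @ concat (map w [0..<i])" if "i \<le> n" for i
    using that by (induction i) (auto simp: w)
  from this[of n] have "W n = W 0 @ concat ws" by (simp add: ws_def)
  moreover obtain y where "u = W n @ y"
    using W[of n] by (auto simp: Sublist.prefix_def)
  ultimately have u: "u = W 0 @ concat ws @ y" by simp
  have "\<forall>v\<in>set ws. \<forall>v'\<in>set ws. parikh v = parikh v'"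
  proof (intro ballI)
    fix v v' assume "v \<in> set ws" "v' \<in> set ws"
    then have "parikh (h v) = parikh (h v')" using q by (auto simp: ws_def)
    then show "parikh v = parikh v'" by (rule parikh_morphism_inject[OF h D1])
  qed
  moreover have "length ws = n" by (simp add: ws_def)
  ultimately have "\<forall>v\<in>set ws. v = []"
    using free u unfolding abelian_power_free_def by blast
  then have "w 0 = []" using n by (auto simp: ws_def)
  then show ?thesis using q[OF n] by (simp add: word_morphism_Nil[OF h])
qed

text \<open>
  Since (D4) says nothing about proper prefixes that are themselves letter images, the images are
  required to form a prefix code.
\<close>

theorem dekking:
  fixes h :: "'a::finite list \<Rightarrow> 'a list"
  assumes h: "word_morphism h" and G: "comm_group G" and f: "monoid_hom word_monoid G f"
    and D: "dekking_conditions h G f n" and n: "n > 0"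
    and code: "\<And>c d. \<not> strict_prefix (h [c]) (h [d])"
    and free: "abelian_power_free n u"
  shows "abelian_power_free n (h u)"
  unfolding abelian_power_free_def
proof (intro allI impI, elim conjE)
  fix x vs y
  assume hu: "h u = x @ concat vs @ y" and len: "length vs = n"
    and eq: "\<forall>v\<in>set vs. \<forall>v'\<in>set vs. parikh v = parikh v'"
  have D1: "dekking_D1 h" and D2: "dekking_D2 h G f" and D3: "dekking_D3 h G f n" and D4: "dekking_D4 h f"
    using D by (auto simp: dekking_conditions_def)
  interpret comm_group G by (rule G)
  have app: "f (x @ y) = f x \<otimes>\<^bsub>G\<^esub> f y" and cl: "f x \<in> carrier G" for x y
    using f by (auto simp: monoid_hom_def hom_def word_monoid_def)
  have image_nonempty: "h [c] \<noteq> []" for c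
    using morphism_nonerasing[OF h D1, of "[c]"] by auto
  define d where "d = f (vs ! 0)"
  define q where "q = parikh (vs ! 0)"
  have vs0: "vs ! 0 \<in> set vs" using n len by auto
  have fd: "f v = d" if "v \<in> set vs" for v
    using group_hom_mset_cong[OF G f] eq that vs0 unfolding d_def parikh_eq_iff_mset by blast
  \<comment> \<open>For \<open>i \<le> n\<close>, these are the prefixes of \<open>h u\<close>
    ending at the \<open>n + 1\<close> block boundaries.\<close>
  define P where "P i = x @ concat (take i vs)" for i
  have P_prefix: "Sublist.prefix (P i) (h u)" for i
    unfolding hu P_def by (metis append_assoc append_take_drop_id concat_append prefixI)
  have fP: "f (P i) = f x \<otimes>\<^bsub>G\<^esub> d [^]\<^bsub>G\<^esub> i" if "i \<le> n" for i
    using that len group_hom_concat[OF G f, of "take i vs" d] fd cl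
    by (auto simp: P_def app d_def dest: in_set_takeD)
  have P_step: "parikh (P (Suc i)) = parikh (P i) + q" if "i < n" for i
  proof -
    have "parikh (vs ! i) = q"
      using that len eq vs0 nth_mem unfolding q_def by blast
    then show ?thesis using that len by (simp add: P_def take_Suc_conv_app_nth add_ac)
  qed
  obtain c0 where c0: "\<And>c. length (h [c]) \<le> length (h [c0])"
    using ex_has_greatest_nat[of "\<lambda>_. True" undefined "\<lambda>c. length (h [c])"
        "Suc (Max (range (\<lambda>c. length (h [c]))))"]
    by (auto simp: less_Suc_eq_le)
  \<comment> \<open>At the end of \<open>h u\<close> no letter follows; there the longest image serves as a dummy complement.\<close>
  have "\<exists>z c t t'. Sublist.prefix z u \<and> P i = h z @ t \<and> t @ t' = h [c] \<and> t' \<noteq> [] \<and>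
      (Sublist.prefix (z @ [c]) u \<or> t = [] \<and> c = c0)" for i
    using prefix_morphism_image_cases[OF h P_prefix[of i]]
  proof
    assume "P i = h u"
    then show ?thesis
      by (intro exI[of _ u] exI[of _ c0] exI[of _ "[]"] exI[of _ "h [c0]"])
        (simp add: image_nonempty)
  next
    assume "\<exists>z c t t'. Sublist.prefix (z @ [c]) u \<and> P i = h z @ t \<and> t @ t' = h [c] \<and> t' \<noteq> []"
    then show ?thesis by (meson append_prefixD)
  qed
  then obtain Z C T T' where Z: "\<And>i. Sublist.prefix (Z i) u" "\<And>i. P i = h (Z i) @ T i"
    and T: "\<And>i. T i @ T' i = h [C i]" "\<And>i. T' i \<noteq> []"
    and ZC: "\<And>i. Sublist.prefix (Z i @ [C i]) u \<or> T i = [] \<and> C i = c0"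
    by metis
  have T_strict: "strict_prefix (T i) (h [C i])" for i
    using T[of i] by (metis strict_prefixI' prefixI prefix_order.less_le append_self_conv)
  have T_Pref: "T i \<in> Pref h - letter_images h" for i
    using prefix_order.less_imp_le[OF T_strict[of i]] T_strict[of i] code
    by (auto simp: Pref_def letter_images_def simp del: strict_prefix_def)
  have fPT: "f (P i) = f (T i)" for i
    by (simp add: Z app cl group_hom_morphism_one[OF G f h D2])
  have "d = \<one>\<^bsub>G\<^esub>"
  proof (rule ccontr)
    assume "d \<noteq> \<one>\<^bsub>G\<^esub>"
    moreover have "f x \<otimes>\<^bsub>G\<^esub> d [^]\<^bsub>G\<^esub> i \<in> f ` Pref h" if "i \<le> n" for i
      using fP[OF that] fPT[of i] T_Pref[of i] by (metis DiffD1 image_eqI)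
    ultimately show False using D3 cl unfolding dekking_D3_def d_def by blast
  qed
  then have fT: "f (T i) = f x" if "i \<le> n" for i
    using fP[OF that] fPT[of i] by (simp add: cl)
  \<comment> \<open>(D4) counts from 1 while the boundaries count from 0, hence
    \<open>r = Suc n\<close> and the shifted indices.\<close>
  have "(\<forall>i\<in>{1..Suc n}. \<forall>j\<in>{1..Suc n}. T (i - 1) = T (j - 1)) \<or>
      (\<forall>i\<in>{1..Suc n}. \<forall>j\<in>{1..Suc n}. T' (i - 1) = T' (j - 1))"
    using T_Pref T fT
    by (intro D4[unfolded dekking_D4_def, rule_format, of "Suc n"]) (auto simp: letter_images_def)
  then have "(\<forall>i\<le>n. T i = T 0) \<or> (\<forall>i\<le>n. T' i = T' 0)"
  proof
    assume *: "\<forall>i\<in>{1..Suc n}. \<forall>j\<in>{1..Suc n}. T (i - 1) = T (j - 1)"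
    have "T i = T 0" if "i \<le> n" for i
      using *[rule_format, of "Suc i" 1] that by simp
    then show ?thesis by blast
  next
    assume *: "\<forall>i\<in>{1..Suc n}. \<forall>j\<in>{1..Suc n}. T' (i - 1) = T' (j - 1)"
    have "T' i = T' 0" if "i \<le> n" for i
      using *[rule_format, of "Suc i" 1] that by simp
    then show ?thesis by blast
  qed
  \<comment> \<open>Equal complements help only if each belongs to a letter really occurring in
    \<open>u\<close>. If a dummy occurs, the common complement is the longest image
    \<open>h [c0]\<close>, which leaves no room for a nonempty \<open>T i\<close>, and the first
    case applies.\<close>
  then consider "\<forall>i\<le>n. T i = T 0" | "\<forall>i\<le>n. T' i = T' 0" "\<forall>i\<le>n. Sublist.prefix (Z i @ [C i]) u"
  proof (elim disjE)
    assume T': "\<forall>i\<le>n. T' i = T' 0"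
    show ?thesis
    proof (cases "\<forall>i\<le>n. Sublist.prefix (Z i @ [C i]) u")
      case False
      then obtain k where k: "k \<le> n" "T k = []" "C k = c0" using ZC by blast
      have "T i = []" if "i \<le> n" for i
      proof -
        have "T' i = T' k" using T' that k(1) by metis
        moreover have "T' k = h [c0]" using T(1)[of k] k by simp
        ultimately have "T' i = h [c0]" by simp
        then have "length (T i) + length (h [c0]) = length (h [C i])"
          using T(1)[of i] by (metis length_append)
        with c0[of "C i"] have "length (T i) = 0" by linarith
        then show ?thesis by simp
      qed
      then show ?thesis using that(1) by simp
    qed (use T' that in blast)
  qed (use that in blast)
  then have "q = 0"
  proof cases
    \<comment> \<open>Dropping the common prefix moves every boundary left to the end of
      \<open>h (Z i)\<close>.\<close>
    case 1
    have "parikh (h (Z (Suc i))) = parikh (h (Z i)) + q" if "i < n" for i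
    proof -
      have "T (Suc i) = T i" using 1 that by (metis Suc_leI less_imp_le)
      with P_step[OF that] show ?thesis by (simp add: Z(2) add_ac vec_eq_iff)
    qed
    then show ?thesis using shifted_abelian_power_trivial[OF h D1 free n, of Z q] Z(1) by blast
  next
    \<comment> \<open>Adding the common complement moves every boundary right to the end of the
      image it cuts.\<close>
    case 2
    have hZC: "h (Z i @ [C i]) = P i @ T' i" for i
      by (simp add: Z(2) T(1) word_morphism_append[OF h])
    have "parikh (h (Z (Suc i) @ [C (Suc i)])) = parikh (h (Z i @ [C i])) + q" if "i < n" for i
    proof -
      have "T' (Suc i) = T' i" using 2(1) that by (metis Suc_leI less_imp_le)
      with P_step[OF that] show ?thesis by (simp add: hZC add_ac)
    qed
    then show ?thesis
      using shifted_abelian_power_trivial[OF h D1 free n, of "\<lambda>i. Z i @ [C i]" q] 2(2) by blast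
  qed
  show "\<forall>v\<in>set vs. v = []"
  proof
    fix v assume "v \<in> set vs"
    then have "parikh v = parikh (vs ! 0)" using eq vs0 by blast
    also have "\<dots> = 0" using \<open>q = 0\<close> by (simp add: q_def)
    finally show "v = []" by simp
  qed
qed

section \<open>Infinite words\<close>

lemma abelian_power_free_append:
  assumes "abelian_power_free n (u @ v)"
  shows "abelian_power_free n u"
  using assms unfolding abelian_power_free_def by (metis append_assoc)

lemma abelian_power_free_prefix:
  "abelian_power_free n v \<Longrightarrow> Sublist.prefix u v \<Longrightarrow> abelian_power_free n u"
  by (auto simp: Sublist.prefix_def dest: abelian_power_free_append)

lemma conc_subsequence_length: "Omega_Words_Fun.prefix (length u) (u \<frown> w) = u"
  by (metis prefix_conc_length)

lemma subsequence_prefix_mono: "m \<le> n \<Longrightarrow> Sublist.prefix (Omega_Words_Fun.prefix m w) (Omega_Words_Fun.prefix n w)"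
  by (metis add_0 le_add_diff_inverse prefixI subsequence_append)

text \<open>A power ends at a finite position, so it already occurs in some prefix. This transfers
  results on finite words to infinite ones.\<close>

lemma abelian_power_free_inf_iff:
  "abelian_power_free_inf k w \<longleftrightarrow> (\<forall>m. abelian_power_free k (Omega_Words_Fun.prefix m w))"
proof
  assume w: "abelian_power_free_inf k w"
  show "\<forall>m. abelian_power_free k (Omega_Words_Fun.prefix m w)"
    unfolding abelian_power_free_def
  proof (intro allI impI, elim conjE)
    fix m x vs y
    assume m: "Omega_Words_Fun.prefix m w = x @ concat vs @ y" and vs: "length vs = k"
      "\<forall>v\<in>set vs. \<forall>v'\<in>set vs. parikh v = parikh v'"
    have "w = (x @ concat vs @ y) \<frown> Omega_Words_Fun.suffix m w"
      unfolding m[symmetric] by (rule prefix_suffix)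
    then have "w = (x @ concat vs) \<frown> (y \<frown> Omega_Words_Fun.suffix m w)" by simp
    with w vs show "\<forall>v\<in>set vs. v = []" unfolding abelian_power_free_inf_def by blast
  qed
next
  assume w: "\<forall>m. abelian_power_free k (Omega_Words_Fun.prefix m w)"
  show "abelian_power_free_inf k w"
    unfolding abelian_power_free_inf_def
  proof (intro allI impI, elim conjE)
    fix x vs y
    assume eq: "w = (x @ concat vs) \<frown> y" and vs: "length vs = k"
      "\<forall>v\<in>set vs. \<forall>v'\<in>set vs. parikh v = parikh v'"
    have "Omega_Words_Fun.prefix (length (x @ concat vs)) w = x @ concat vs @ []"
      unfolding eq conc_subsequence_length by simp
    with w vs show "\<forall>v\<in>set vs. v = []" unfolding abelian_power_free_def by blast
  qed
qed

text \<open>Each prefix of \<open>w'\<close> lies inside the image of a prefix of \<open>w\<close>,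
  so the finite case suffices.\<close>

lemma abelian_power_free_morphismI:
  assumes h: "\<And>u. abelian_power_free n u \<Longrightarrow> abelian_power_free n (h u)"
  shows "abelian_power_free_morphism n h"
  unfolding abelian_power_free_morphism_def
proof (intro conjI allI impI)
  fix w w' assume "abelian_power_free_inf n w \<and> infinite_image h w w'"
  then have w: "abelian_power_free_inf n w" and im: "infinite_image h w w'" by auto
  show "abelian_power_free_inf n w'"
    unfolding abelian_power_free_inf_iff
  proof
    fix m
    obtain k where k: "m \<le> length (h (Omega_Words_Fun.prefix k w))"
      using im unfolding infinite_image_def by blast
    have "abelian_power_free n (h (Omega_Words_Fun.prefix k w))"
      using h w by (simp add: abelian_power_free_inf_iff)
    then have "abelian_power_free n (Omega_Words_Fun.prefix (length (h (Omega_Words_Fun.prefix k w))) w')"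
      using im unfolding infinite_image_def by metis
    then show "abelian_power_free n (Omega_Words_Fun.prefix m w')"
      by (rule abelian_power_free_prefix[OF _ subsequence_prefix_mono[OF k]])
  qed
qed (rule h)

section \<open>Fixed points as limits of iterates\<close>

text \<open>A diagonal reading of the iterates. Under the assumptions of the context below, iterate
  \<open>n\<close> has more than \<open>n\<close> letters and is a prefix of all later ones, so the
  choice of iterate does not matter.\<close>

definition iterate_limit :: "('a list \<Rightarrow> 'a list) \<Rightarrow> 'a \<Rightarrow> nat \<Rightarrow> 'a" where
  "iterate_limit h a n = ((h ^^ n) [a]) ! n"

context
  fixes h :: "'a list \<Rightarrow> 'a list" and a :: 'a and r :: "'a list"
  assumes h: "word_morphism h" and ha: "h [a] = a # r" and r: "r \<noteq> []"
    and ne: "\<And>c. h [c] \<noteq> []"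
begin

lemma morphism_length_ge: "length u \<le> length (h u)"
proof (induction u)
  case (Cons c u)
  have "length (h [c]) \<ge> 1" using ne[of c] by (simp add: Suc_leI)
  with Cons show ?case by (simp add: word_morphism_Cons[OF h, of c u])
qed simp

text \<open>Applying \<open>h\<close> to one proper extension yields the next; the first is
  \<open>h [a] = a # r\<close>.\<close>

lemma iterate_decompose: "\<exists>s. (h ^^ Suc n) [a] = (h ^^ n) [a] @ s \<and> s \<noteq> []"
proof (induction n)
  case 0
  then show ?case using ha r by simp
next
  case (Suc n)
  then obtain s where s: "(h ^^ Suc n) [a] = (h ^^ n) [a] @ s" "s \<noteq> []" by blast
  have "(h ^^ Suc (Suc n)) [a] = (h ^^ Suc n) [a] @ h s"
    using s(1) by (simp add: word_morphism_append[OF h])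
  moreover have "h s \<noteq> []" using morphism_length_ge[of s] s(2) by auto
  ultimately show ?case by blast
qed

lemma iterate_prefix: "m \<le> n \<Longrightarrow> Sublist.prefix ((h ^^ m) [a]) ((h ^^ n) [a])"
proof (induction n rule: dec_induct)
  case (step n)
  then show ?case using iterate_decompose[of n] by (metis prefixI prefix_order.trans)
qed simp

lemma iterate_length: "n < length ((h ^^ n) [a])"
proof (induction n)
  case (Suc n)
  obtain s where "(h ^^ Suc n) [a] = (h ^^ n) [a] @ s" "s \<noteq> []" using iterate_decompose by blast
  then have "length ((h ^^ n) [a]) < length ((h ^^ Suc n) [a])"
    by (simp del: funpow.simps)
  with Suc show ?case by linarith
qed simp

lemma iterate_limit_prefix: "Omega_Words_Fun.prefix (length ((h ^^ n) [a])) (iterate_limit h a) = (h ^^ n) [a]"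
proof (rule nth_equalityI)
  fix k assume "k < length (Omega_Words_Fun.prefix (length ((h ^^ n) [a])) (iterate_limit h a))"
  then have k: "k < length ((h ^^ n) [a])" by simp
  have "((h ^^ k) [a]) ! k = ((h ^^ n) [a]) ! k"
  proof (cases "k \<le> n")
    case True
    then show ?thesis using iterate_prefix[OF True] iterate_length[of k]
      by (auto simp: Sublist.prefix_def nth_append)
  next
    case False
    then have "n \<le> k" by simp
    from iterate_prefix[OF this] k show ?thesis
      by (auto simp: Sublist.prefix_def nth_append)
  qed
  then show "(Omega_Words_Fun.prefix (length ((h ^^ n) [a])) (iterate_limit h a)) ! k = ((h ^^ n) [a]) ! k"
    using k by (simp add: iterate_limit_def)
qed simp

lemma prefix_iterate_limit: "Sublist.prefix (Omega_Words_Fun.prefix m (iterate_limit h a)) ((h ^^ m) [a])"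
  using subsequence_prefix_mono[OF less_imp_le[OF iterate_length[of m]], of "iterate_limit h a"]
  by (simp only: iterate_limit_prefix)

lemma iterate_limit_fixed_point: "infinite_fixed_point h (iterate_limit h a)"
  unfolding infinite_fixed_point_def infinite_image_def
proof (intro conjI allI)
  fix m
  show "\<exists>k. m \<le> length (h (Omega_Words_Fun.prefix k (iterate_limit h a)))"
    using morphism_length_ge[of "Omega_Words_Fun.prefix m (iterate_limit h a)"] by auto
  \<comment> \<open>The image of a prefix of the limit is a prefix of the next iterate, which is
    itself a prefix of the limit.\<close>
  have "Sublist.prefix (h (Omega_Words_Fun.prefix m (iterate_limit h a))) ((h ^^ Suc m) [a])"
    using word_morphism_prefix[OF h prefix_iterate_limit[of m]] by simp
  then obtain s where s: "(h ^^ Suc m) [a] = h (Omega_Words_Fun.prefix m (iterate_limit h a)) @ s"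
    by (auto simp: Sublist.prefix_def)
  define l where "l = length (h (Omega_Words_Fun.prefix m (iterate_limit h a)))"
  have l: "l \<le> length ((h ^^ Suc m) [a])"
    unfolding s by (simp add: l_def)
  have "h (Omega_Words_Fun.prefix m (iterate_limit h a)) = take l ((h ^^ Suc m) [a])"
    unfolding s by (simp add: l_def)
  also have "\<dots> = Omega_Words_Fun.prefix l (iterate_limit h a)"
    using arg_cong[OF iterate_limit_prefix[of "Suc m"], of "take l"] l
    by (simp add: min_absorb1 min_absorb2 del: funpow.simps)
  finally show "h (Omega_Words_Fun.prefix m (iterate_limit h a)) =
      (Omega_Words_Fun.prefix (length (h (Omega_Words_Fun.prefix m (iterate_limit h a)))) (iterate_limit h a))"
    by (simp add: l_def)
qed

text \<open>A factor lies in some iterate; passing to the following iterate makes the surrounding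
  word an image under \<open>h\<close>, so properties of all images apply.\<close>

lemma iterate_limit_factor:
  assumes "is_factor u (iterate_limit h a)"
  shows "\<exists>x y v. h v = x @ u @ y"
proof -
  obtain x y where xy: "iterate_limit h a = (x @ u) \<frown> y"
    using assms by (auto simp: is_factor_def)
  define m where "m = length (x @ u)"
  have "Sublist.prefix (Omega_Words_Fun.prefix m (iterate_limit h a)) ((h ^^ m) [a])"
    by (rule prefix_iterate_limit)
  moreover have "Omega_Words_Fun.prefix m (iterate_limit h a) = x @ u"
    unfolding m_def xy by (rule conc_subsequence_length)
  ultimately have "Sublist.prefix (x @ u) ((h ^^ Suc m) [a])"
    using iterate_prefix[of m "Suc m"] by (metis le_SucI order_refl prefix_order.trans)
  then show ?thesis by (auto simp: Sublist.prefix_def intro: exI[of _ "(h ^^ m) [a]"])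
qed

end

lemma iterate_limit_abelian_power_free:
  fixes h :: "'a::finite list \<Rightarrow> 'a list"
  assumes "word_morphism h" and "h [a] = a # r" and "r \<noteq> []" and "\<And>c. h [c] \<noteq> []"
    and "abelian_power_free n [a]" and "\<And>u. abelian_power_free n u \<Longrightarrow> abelian_power_free n (h u)"
  shows "abelian_power_free_inf n (iterate_limit h a)"
proof -
  have "abelian_power_free n ((h ^^ m) [a])" for m
    by (induction m) (use assms(5,6) in auto)
  then show ?thesis
    using abelian_power_free_prefix prefix_iterate_limit[OF assms(1-4)]
    by (metis abelian_power_free_inf_iff)
qed

section \<open>The morphism\<close>

primrec letter_image :: "letter \<Rightarrow> letter list" where
  "letter_image La = [La, La, Lb, La, La, La, Lb]"
| "letter_image Lb = [La, La, Lb, La, Lb, La, Lb, La, Lb, La, Lb]"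

definition morph :: "letter list \<Rightarrow> letter list" where
  "morph u = concat (map letter_image u)"

primrec weight :: "letter \<Rightarrow> int" where
  "weight La = 1"
| "weight Lb = 4"

definition weight_sum :: "letter list \<Rightarrow> int" where
  "weight_sum u = sum_list (map weight u) mod 13"

lemma UNIV_letter: "UNIV = {La, Lb}"
  using letter.exhaust by auto

lemma all_letter: "(\<forall>c. P c) \<longleftrightarrow> P La \<and> P Lb"
  by (metis letter.exhaust)

lemma morph_singleton [simp]: "morph [c] = letter_image c"
  by (simp add: morph_def)

lemma word_morphism_morph: "word_morphism morph"
  by (auto simp: monoid_hom_def hom_def word_monoid_def morph_def)

lemma weight_sum_hom: "monoid_hom word_monoid (integer_mod_group 13) weight_sum"
  by (auto simp: monoid_hom_def hom_def word_monoid_def weight_sum_def carrier_integer_mod_group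
      mod_add_eq)

section \<open>Dekking's conditions for the morphism\<close>

lemma morph_D1: "dekking_D1 morph"
proof -
  \<comment> \<open>The inverse of the matrix with rows (5, 2) and (6, 5), whose determinant is
    13.\<close>
  define B :: "real ^ letter ^ letter" where
    "B = (\<chi> i j. if i = La then (if j = La then 5/13 else -2/13) else (if j = La then -6/13 else 5/13))"
  have "frequency_matrix morph ** B = mat 1" "B ** frequency_matrix morph = mat 1"
    by (simp_all add: vec_eq_iff matrix_matrix_mult_def frequency_matrix_def B_def mat_def
        UNIV_letter all_letter)
  then show ?thesis by (auto simp: dekking_D1_def invertible_def)
qed

lemma morph_D2: "dekking_D2 morph (integer_mod_group 13) weight_sum"
  unfolding dekking_D2_def
proof
  fix s show "weight_sum (morph [s]) = \<one>\<^bsub>integer_mod_group 13\<^esub>"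
    by (cases s) (simp_all add: weight_sum_def)
qed

text \<open>As 13 is prime, the 12 terms are distinct and cannot avoid two residues. Finite lists
  let evaluation decide the claim.\<close>

lemma residue_progression_hits:
  "\<forall>g\<in>set [0..12]. \<forall>d\<in>set [1..12]. \<exists>i\<in>set [0..<12]. (g + int i * d) mod 13 \<in> set [5, 10]"
  by code_simp

lemma morph_Pref:
  assumes "v \<in> Pref morph"
  shows "weight_sum v \<notin> {5, 10}"
proof -
  obtain s where "Sublist.prefix v (letter_image s)" using assms by (auto simp: Pref_def)
  then show ?thesis by (cases s) (auto simp: prefix_Cons weight_sum_def)
qed

lemma morph_D3: "dekking_D3 morph (integer_mod_group 13) weight_sum 11"
  unfolding dekking_D3_def
proof (intro notI, elim bexE conjE)
  fix g d
  assume g: "g \<in> carrier (integer_mod_group 13)" and d: "d \<in> carrier (integer_mod_group 13)"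
    and d1: "d \<noteq> \<one>\<^bsub>integer_mod_group 13\<^esub>"
    and ap: "\<forall>i::nat\<le>11. g \<otimes>\<^bsub>integer_mod_group 13\<^esub> d [^]\<^bsub>integer_mod_group 13\<^esub> i \<in> weight_sum ` Pref morph"
  have "g \<in> set [0..12]" "d \<in> set [1..12]"
    using g d d1 by (auto simp: carrier_integer_mod_group)
  then obtain i where "i \<in> set [0..<12]" "(g + int i * d) mod 13 \<in> set [5, 10]"
    using residue_progression_hits by blast
  then have i: "i \<le> 11" "(g + int i * d) mod 13 \<in> {5, 10}"
    by auto
  have "g \<otimes>\<^bsub>integer_mod_group 13\<^esub> d [^]\<^bsub>integer_mod_group 13\<^esub> i = (g + int i * d) mod 13"
    by (simp add: mod_add_right_eq)
  then have "(g + int i * d) mod 13 \<in> weight_sum ` Pref morph"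
    using ap i(1) by metis
  then obtain v where "v \<in> Pref morph" "weight_sum v = (g + int i * d) mod 13"
    by auto
  with i(2) morph_Pref[of v] show False by simp
qed

text \<open>The range of \<open>k\<close> stops short of the full length, so every second component
  is nonempty.\<close>

definition splits :: "(letter list \<times> letter list) list" where
  "splits = concat (map (\<lambda>s. map (\<lambda>k. (take k (letter_image s), drop k (letter_image s)))
     [0..<length (letter_image s)]) [La, Lb])"

text \<open>Only the residues 8 and 9 come from two different proper prefixes, one in each image;
  there the complements agree, being \<open>ab\<close> and \<open>b\<close> respectively.\<close>

lemma splits_separated:
  "\<forall>p\<in>set splits. \<forall>q\<in>set splits. weight_sum (fst p) = weight_sum (fst q) \<longrightarrow>
     (if weight_sum (fst p) \<in> {8, 9} then snd p = snd q else fst p = fst q)"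
  by code_simp

lemma in_splits:
  assumes "v \<in> Pref morph - letter_images morph" and "v @ v' \<in> letter_images morph"
  shows "(v, v') \<in> set splits"
proof -
  obtain s where s: "v @ v' = letter_image s" using assms(2) by (auto simp: letter_images_def)
  have "v' \<noteq> []" using assms by auto
  then have len: "length v \<in> set [0..<length (letter_image s)]" by (simp flip: s)
  have "(v, v') = (take (length v) (letter_image s), drop (length v) (letter_image s))"
    by (simp flip: s)
  then have "(v, v') \<in> (\<lambda>k. (take k (letter_image s), drop k (letter_image s))) `
      set [0..<length (letter_image s)]"
    using len by (rule image_eqI)
  moreover have "s \<in> set [La, Lb]" by (cases s) simp_all
  ultimately show ?thesis
    unfolding splits_def set_concat set_map image_image by (rule UN_I[rotated])
qed

lemma morph_D4: "dekking_D4 morph weight_sum"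
  unfolding dekking_D4_def
proof (intro allI impI, elim conjE)
  fix r :: nat and v v' :: "nat \<Rightarrow> letter list"
  assume r: "1 \<le> r"
    and v: "\<forall>i\<in>{1..r}. v i \<in> Pref morph - letter_images morph \<and> v i @ v' i \<in> letter_images morph"
    and eq: "\<forall>i\<in>{1..r}. \<forall>j\<in>{1..r}. weight_sum (v i) = weight_sum (v j)"
  \<comment> \<open>Testing the residue of \<open>v 1\<close>, which all the others share, selects
    the same alternative for every pair.\<close>
  have "if weight_sum (v 1) \<in> {8, 9} then v' i = v' j else v i = v j"
    if i: "i \<in> {1..r}" and j: "j \<in> {1..r}" for i j
  proof -
    have "(v i, v' i) \<in> set splits" "(v j, v' j) \<in> set splits"
      using v i j in_splits by blast+
    moreover have "1 \<in> {1..r}" using r by simp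
    then have "weight_sum (v i) = weight_sum (v j)" "weight_sum (v 1) = weight_sum (v i)"
      using eq i j by blast+
    ultimately show ?thesis
      using splits_separated[rule_format, of "(v i, v' i)" "(v j, v' j)"] by (auto split: if_splits)
  qed
  then show "(\<forall>i\<in>{1..r}. \<forall>j\<in>{1..r}. v i = v j) \<or> (\<forall>i\<in>{1..r}. \<forall>j\<in>{1..r}. v' i = v' j)"
    by (smt (verit))
qed

lemma morph_conditions: "dekking_conditions morph (integer_mod_group 13) weight_sum 11"
  by (simp add: dekking_conditions_def morph_D1 morph_D2 morph_D3 morph_D4)

lemma morph_abelian_power_free:
  assumes "abelian_power_free 11 u"
  shows "abelian_power_free 11 (morph u)"
proof (rule dekking[OF word_morphism_morph _ weight_sum_hom morph_conditions])
  \<comment> \<open>The two images agree on \<open>aaba\<close> and differ in the fifth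
    letter.\<close>
  show "\<not> strict_prefix (morph [c]) (morph [d])" for c d
    by (cases c; cases d) simp_all
qed (use assms in simp_all)

text \<open>
  The state \<open>Some i\<close> means that the last \<open>b\<close> was followed by \<open>i\<close> letters \<open>a\<close>; the automaton fails
  on \<open>aaaa\<close> and on \<open>bb\<close>, and the image of each letter leads from \<open>Some 0\<close> back to \<open>Some 0\<close>.
\<close>

fun run_step :: "letter \<Rightarrow> nat option \<Rightarrow> nat option" where
  "run_step _ None = None"
| "run_step La (Some i) = (if i < 3 then Some (Suc i) else None)"
| "run_step Lb (Some i) = (if i > 0 then Some 0 else None)"

lemma fold_run_step_None [simp]: "fold run_step u None = None"
  by (induction u) simp_all

lemma fold_run_step_morph: "fold run_step (morph u) (Some 0) = Some 0"
proof (induction u)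
  case (Cons c u)
  then show ?case by (cases c) (simp_all add: morph_def)
qed (simp add: morph_def)

text \<open>Failure is absorbing: a factor that fails from every state would make the whole word
  fail, but images end in \<open>Some 0\<close>.\<close>

lemma morph_not_factor:
  assumes "\<And>s. fold run_step u s = None"
  shows "morph v \<noteq> x @ u @ y"
  using fold_run_step_morph[of v] assms by auto

theorem theorem2p23:
  shows "\<exists>(h :: letter list \<Rightarrow> letter list) (G :: int monoid) (f :: letter list \<Rightarrow> int)
            (\<Omega> :: nat \<Rightarrow> letter).
           word_morphism h \<and>
           comm_group G \<and> finite (carrier G) \<and>
           monoid_hom word_monoid G f \<and>
           dekking_conditions h G f 11 \<and>
           abelian_power_free_morphism 11 h \<and>
           infinite_fixed_point h \<Omega> \<and>
           \<not> is_factor [La, La, La, La] \<Omega> \<and>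
           \<not> is_factor [Lb, Lb] \<Omega> \<and>
           abelian_power_free_inf 11 \<Omega>"
proof -
  note morph_La = word_morphism_morph morph_singleton[of La, unfolded letter_image.simps] list.distinct(2)
  have ne: "morph [c] \<noteq> []" for c by (cases c) simp_all
  have "fold run_step [La, La, La, La] s = None" for s by (cases s) auto
  then have "\<not> is_factor [La, La, La, La] (iterate_limit morph La)"
    using iterate_limit_factor[OF morph_La ne] morph_not_factor by metis
  moreover have "fold run_step [Lb, Lb] s = None" for s by (cases s) auto
  then have "\<not> is_factor [Lb, Lb] (iterate_limit morph La)"
    using iterate_limit_factor[OF morph_La ne] morph_not_factor by metis
  moreover have "abelian_power_free 11 [La]"
    unfolding abelian_power_free_def
  proof (intro allI impI, elim conjE)
    fix x vs y
    assume u: "[La] = x @ concat vs @ y" and len: "length vs = 11"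
      and eq: "\<forall>v\<in>set vs. \<forall>v'\<in>set vs. parikh v = parikh v'"
    show "\<forall>v\<in>set vs. v = []"
    proof (rule ccontr)
      assume "\<not> (\<forall>v\<in>set vs. v = [])"
      \<comment> \<open>Equal Parikh vectors make all blocks nonempty as soon as one is, and eleven
        nonempty blocks do not fit into a single letter.\<close>
      then have "\<forall>v\<in>set vs. v \<noteq> []" using eq parikh_eq_0_iff by metis
      then have "sum_list (map (\<lambda>_. 1) vs) \<le> sum_list (map length vs)"
        by (intro sum_list_mono) (simp add: Suc_leI)
      then have "11 \<le> length (concat vs)" using len by (simp add: length_concat sum_list_triv)
      moreover have "length (concat vs) \<le> 1" using arg_cong[OF u, of length] by simp
      ultimately show False by simp
    qed
  qed
  then have "abelian_power_free_inf 11 (iterate_limit morph La)"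
    using iterate_limit_abelian_power_free[OF morph_La ne] morph_abelian_power_free by blast
  moreover have "infinite_fixed_point morph (iterate_limit morph La)"
    by (rule iterate_limit_fixed_point[OF morph_La ne])
  moreover have "abelian_power_free_morphism 11 morph"
    using morph_abelian_power_free by (rule abelian_power_free_morphismI)
  moreover have "finite (carrier (integer_mod_group 13))"
    by (simp add: carrier_integer_mod_group)
  ultimately show ?thesis
    using word_morphism_morph abelian_integer_mod_group weight_sum_hom morph_conditions by blast
qed

end
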